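(* There is an absolute constant $c>0$ such that for every finite nonempty set $A$ of nonzero complex numbers, $$\left|\frac{A+A}{A+A}\right|\geq c|A|^2.$$
   Context: $\frac{A+A}{A+A}:=\left\{\frac{a+b}{c+d}: a,b,c,d\in A,\ c+d\neq 0\right\}$. *)

theory Defs
  imports Complex_Main
begin

definition sumquot :: "complex set \<Rightarrow> complex set" where
  "sumquot A = {(a + b) / (c + d) | a b c d. a \<in> A \<and> b \<in> A \<and> c \<in> A \<and> d \<in> A \<and> c + d \<noteq> 0}"

end

theory Submission
  imports Defs
begin

text \<open>
  Restrict \<open>A\<close> to a quadrant \<open>B\<close>, losing a factor 4; there \<open>norm d \<le> norm (c + d)\<close>.
  For \<open>a, c \<in> B\<close> put \<open>z = a / c\<close> and let \<open>w = e / d\<close> be the quotient of elements of \<open>B\<close>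
  which is nearest to \<open>z\<close>. Then \<open>x = (a + e) / (c + d) = z + (w - z) * (d / (c + d))\<close> is an
  element of \<open>sumquot A\<close> no further from \<open>z\<close> than \<open>w\<close> is, and for fixed \<open>z\<close> it determines
  \<open>c\<close>. If two quotients \<open>z\<close>, \<open>z'\<close> share the same \<open>x\<close> and \<open>z - x\<close>, \<open>z' - x\<close>
  lie in the same octant, then the one further from \<open>x\<close> is nearer to the other quotient
  than to \<open>x\<close>, against the choice of its nearest neighbour. So \<open>x\<close> and the octant of
  \<open>z - x\<close> determine \<open>(a, c)\<close>, and \<open>card B ^ 2 \<le> 8 * card (sumquot A)\<close>.
\<close>

definition quadrant :: "complex \<Rightarrow> bool \<times> bool" where
  "quadrant u = (Re u \<ge> 0, Im u \<ge> 0)"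

text \<open>A sector must be narrower than 60 degrees for the comparison of distances; a quadrant is
  too wide, so the diagonals cut it in half. Coding sectors by truth values makes their number the
  size of a finite type, here 8.\<close>

definition octant :: "complex \<Rightarrow> (bool \<times> bool) \<times> bool" where
  "octant u = (quadrant u, \<bar>Re u\<bar> \<ge> \<bar>Im u\<bar>)"

text \<open>Corresponding coordinates have the same sign, so the cross terms in the square of the
  norm of \<open>c + d\<close> are nonnegative.\<close>

lemma norm_le_norm_add_if_quadrant_eq:
  assumes "quadrant c = quadrant d"
  shows "norm d \<le> norm (c + d)"
proof -
  have "Re c * Re d \<ge> 0" "Im c * Im d \<ge> 0"
    using assms by (auto simp: quadrant_def zero_le_mult_iff)
  then have "(Re d)\<^sup>2 + (Im d)\<^sup>2 \<le> (Re c + Re d)\<^sup>2 + (Im c + Im d)\<^sup>2"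
    by (simp add: power2_sum add_increasing)
  then show ?thesis
    by (simp add: cmod_def)
qed

text \<open>The vectors \<open>(a, b)\<close> and \<open>(c, d)\<close> are at most 45 degrees
  apart, so the cosine of their angle exceeds 1/2 and twice their inner product exceeds the product
  of their lengths. Comparing \<open>a\<close> with \<open>c\<close> avoids square roots.\<close>

lemma diagonal_wedge_sq_lt:
  fixes a b c d :: real
  assumes "0 \<le> b" "b \<le> a" "0 \<le> d" "d \<le> c" "c\<^sup>2 + d\<^sup>2 \<le> a\<^sup>2 + b\<^sup>2" "0 < c"
  shows "c\<^sup>2 + d\<^sup>2 < 2 * (a * c + b * d)"
proof (cases "a < c")
  case True
  have "a\<^sup>2 + b\<^sup>2 > 0"
    using assms by (smt (verit) zero_less_power zero_le_power2)
  then have "a > 0"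
    using assms by (cases "a = 0") auto
  then have "a * a < a * c" "b\<^sup>2 \<le> a\<^sup>2"
    using True assms by (auto intro: power_mono)
  moreover have "0 \<le> b * d"
    using assms by simp
  ultimately show ?thesis
    using assms(5) by (simp add: power2_eq_square)
next
  case False
  have le: "c * c \<le> a * c" "d * d \<le> c * c" "0 \<le> b * d"
    using False assms by (auto intro: mult_mono)
  show ?thesis
  proof (cases "a = c")
    case True
    then have "d \<le> b"
      using assms by (auto dest: power2_le_imp_le)
    then have "d * d \<le> b * d"
      using assms by (intro mult_right_mono)
    moreover have "0 < c * c"
      using assms by simp
    ultimately show ?thesis
      using le True by (simp add: power2_eq_square)
  next
    case neq: False
    then have "c * c < a * c"
      using False assms by simp
    then show ?thesis
      using le by (simp add: power2_eq_square)
  qed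
qed

text \<open>By the law of cosines it suffices that twice the inner product exceeds the square of
  \<open>norm v\<close>. Reflections in the axes and in the diagonal reduce this to the wedge below
  the diagonal.\<close>

lemma norm_diff_less_if_octant_eq:
  assumes "octant u = octant v" "v \<noteq> 0" "norm v \<le> norm u"
  shows "norm (u - v) < norm u"
proof -
  define a b c d where "a = \<bar>Re u\<bar>" "b = \<bar>Im u\<bar>" "c = \<bar>Re v\<bar>" "d = \<bar>Im v\<bar>"
  note abcd = this
  have prods: "a * c = Re u * Re v" "b * d = Im u * Im v"
    using assms(1) by (auto simp: abcd octant_def quadrant_def abs_if split: if_splits)
  have le: "c\<^sup>2 + d\<^sup>2 \<le> a\<^sup>2 + b\<^sup>2"
    using assms(3) by (simp add: abcd cmod_def)
  have nz: "c \<noteq> 0 \<or> d \<noteq> 0"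
    using assms(2) by (auto simp: abcd complex_eq_iff)
  have nn: "a \<ge> 0" "b \<ge> 0" "c \<ge> 0" "d \<ge> 0"
    by (auto simp: abcd)
  have ord: "b \<le> a \<and> d \<le> c \<or> a \<le> b \<and> c \<le> d"
    using assms(1) by (auto simp: abcd octant_def)
  then have "c\<^sup>2 + d\<^sup>2 < 2 * (a * c + b * d)"
    using diagonal_wedge_sq_lt[of b a d c] diagonal_wedge_sq_lt[of a b c d] nn nz le
    by (auto simp: add.commute)
  then have "(Re v)\<^sup>2 + (Im v)\<^sup>2 < 2 * (Re u * Re v + Im u * Im v)"
    by (simp add: prods) (simp add: abcd)
  then have "(Re u - Re v)\<^sup>2 + (Im u - Im v)\<^sup>2 < (Re u)\<^sup>2 + (Im u)\<^sup>2"
    by (simp add: power2_diff algebra_simps)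
  then show ?thesis
    by (simp add: cmod_def)
qed

lemma card_le_card_quadrant:
  assumes "finite A"
  shows "\<exists>B \<subseteq> A. card A \<le> 4 * card B \<and> (\<forall>c\<in>B. \<forall>d\<in>B. quadrant c = quadrant d)"
proof (rule ccontr)
  assume neg: "\<not> ?thesis"
  let ?B = "\<lambda>q. {c \<in> A. quadrant c = q}"
  have small: "4 * card (?B q) < card A" for q
  proof -
    have "?B q \<subseteq> A" "\<forall>c\<in>?B q. \<forall>d\<in>?B q. quadrant c = quadrant d"
      by auto
    then show ?thesis
      using neg by (meson not_le)
  qed
  have "card A = (\<Sum>q\<in>UNIV. card (?B q))"
    using sum.group[OF assms, of UNIV quadrant "\<lambda>_. 1 :: nat"] by simp
  also have "4 * \<dots> < (\<Sum>q\<in>(UNIV :: (bool \<times> bool) set). card A)"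
    unfolding sum_distrib_left by (rule sum_strict_mono) (use small in auto)
  finally show False
    by (simp add: card_UNIV_bool flip: UNIV_Times_UNIV)
qed

lemma sumquot_mono: "B \<subseteq> A \<Longrightarrow> sumquot B \<subseteq> sumquot A"
  unfolding sumquot_def by blast

lemma finite_sumquot:
  assumes "finite A"
  shows "finite (sumquot A)"
proof (rule finite_subset)
  show "sumquot A \<subseteq> (\<lambda>(a, b, c, d). (a + b) / (c + d)) ` (A \<times> A \<times> A \<times> A)"
    unfolding sumquot_def by force
qed (use assms in simp)

lemma ex_nearest_quotient:
  fixes B :: "complex set"
  assumes "finite B" "0 \<notin> B" "a \<in> B" "b \<in> B" "a \<noteq> b"
  shows "\<exists>e d. e \<in> B \<and> d \<in> B \<and> e / d \<noteq> z \<and>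
           (\<forall>a'\<in>B. \<forall>c'\<in>B. a' / c' \<noteq> z \<longrightarrow> dist z (e / d) \<le> dist z (a' / c'))"
proof -
  define R where "R = (\<lambda>(a, c). a / c) ` (B \<times> B)"
  \<comment> \<open>Two distinct quotients guarantee that one remains after removing
    \<open>z\<close>.\<close>
  have "a / a \<in> R" "a / b \<in> R"
    unfolding R_def using assms by force+
  moreover have "a \<noteq> 0"
    using assms(2,3) by auto
  then have "a / a \<noteq> a / b"
    using assms(5) by auto
  ultimately have "R - {z} \<noteq> {}"
    by blast
  moreover have "finite (R - {z})"
    unfolding R_def using assms(1) by simp
  ultimately obtain w where w: "w \<in> R - {z}" "\<forall>y\<in>R - {z}. dist z w \<le> dist z y"
    using ex_is_arg_min_if_finite[of "R - {z}" "dist z"] by (auto simp: is_arg_min_linorder)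
  then obtain e d where "e \<in> B" "d \<in> B" "w = e / d"
    by (auto simp: R_def)
  with w show ?thesis
    by (intro exI[of _ e] exI[of _ d]) (auto simp: R_def)
qed

lemma card_sq_le_card_sumquot:
  assumes "finite B" "0 \<notin> B" and quad: "\<And>c d. c \<in> B \<Longrightarrow> d \<in> B \<Longrightarrow> quadrant c = quadrant d"
    and "a0 \<in> B" "b0 \<in> B" "a0 \<noteq> b0"
  shows "card B ^ 2 \<le> 8 * card (sumquot B)"
proof -
  \<comment> \<open>\<open>e\<close> and \<open>d\<close> depend on the quotient \<open>z\<close>
    alone, not on the pair representing it; the recovery of \<open>c\<close> from
    \<open>f (a, c)\<close> relies on this.\<close>
  obtain e d where ed: "\<And>z. e z \<in> B" "\<And>z. d z \<in> B" "\<And>z. e z / d z \<noteq> z"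
    "\<And>z a' c'. a' \<in> B \<Longrightarrow> c' \<in> B \<Longrightarrow> a' / c' \<noteq> z \<Longrightarrow> dist z (e z / d z) \<le> dist z (a' / c')"
    using ex_nearest_quotient[OF assms(1,2,4-6)] by metis
  define f where "f = (\<lambda>(a, c). (a + e (a / c)) / (c + d (a / c)))"
  define F where "F = (\<lambda>p. (f p, octant (fst p / snd p - f p)))"
  have nz: "c \<noteq> 0" if "c \<in> B" for c
    using that assms(2) by auto
  have norm_le: "norm (d z) \<le> norm (c + d z)" if "c \<in> B" for c z
    using norm_le_norm_add_if_quadrant_eq quad ed that by blast
  have sum_nz: "c + d z \<noteq> 0" if "c \<in> B" for c z
    using norm_le[OF that, of z] nz[OF ed(2)] by auto
  have f_eq: "f (a, c) - a / c = (e z / d z - z) * (d z / (c + d z))"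
    if "a \<in> B" "c \<in> B" "z = a / c" for a c z
  proof -
    have "f (a, c) = (z * c + e z) / (c + d z)"
      using nz[OF that(2)] by (simp add: f_def that(3))
    moreover have "(z * c + e z) / (c + d z) - z = (e z / d z - z) * (d z / (c + d z))"
      using nz[OF ed(2), of z] sum_nz[OF that(2), of z]
      by (simp add: divide_simps) (simp add: algebra_simps)
    ultimately show ?thesis
      using that(3) by simp
  qed
  have f_ne: "f (a, c) \<noteq> a / c" if "a \<in> B" "c \<in> B" for a c
    using f_eq[OF that refl] ed(3) nz[OF ed(2)] sum_nz[OF that(2)] by auto
  have near: "norm (a / c - f (a, c)) \<le> dist (a / c) (e (a / c) / d (a / c))"
    if "a \<in> B" "c \<in> B" for a c
  proof -
    have "norm (d (a / c) / (c + d (a / c))) \<le> 1"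
      using norm_le[OF that(2), of "a / c"] by (auto simp: norm_divide divide_le_eq_1)
    then have "norm (f (a, c) - a / c) \<le> norm (e (a / c) / d (a / c) - a / c)"
      unfolding f_eq[OF that refl] norm_mult by (intro mult_left_le) auto
    then show ?thesis
      by (simp add: dist_norm norm_minus_commute)
  qed
  have not_further: False
    if B: "a \<in> B" "c \<in> B" "a' \<in> B" "c' \<in> B" and eq: "F (a, c) = F (a', c')"
      and ne: "a / c \<noteq> a' / c'"
      and le: "norm (a' / c' - f (a', c')) \<le> norm (a / c - f (a, c))" for a c a' c'
  proof -
    \<comment> \<open>The common value of \<open>f\<close> cancels, so the chain bounds the distance
      between the two quotients strictly by itself. Strictness needs a nonzero second offset, which
      \<open>f_ne\<close> supplies.\<close>
    have "norm ((a / c - f (a, c)) - (a' / c' - f (a', c'))) < norm (a / c - f (a, c))"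
      by (rule norm_diff_less_if_octant_eq) (use eq le f_ne[OF B(3,4)] in \<open>auto simp: F_def\<close>)
    also have "(a / c - f (a, c)) - (a' / c' - f (a', c')) = a / c - a' / c'"
      using eq by (simp add: F_def)
    also note near[OF B(1,2)]
    also have "dist (a / c) (e (a / c) / d (a / c)) \<le> dist (a / c) (a' / c')"
      using ed(4) B(3,4) ne by metis
    finally show False
      by (simp add: dist_norm)
  qed
  have "inj_on F (B \<times> B)"
  proof (rule inj_onI, clarify)
    fix a c a' c'
    assume B: "a \<in> B" "c \<in> B" "a' \<in> B" "c' \<in> B" and eq: "F (a, c) = F (a', c')"
    have z: "a / c = a' / c'"
    proof (rule ccontr)
      assume "a / c \<noteq> a' / c'"
      then show False
        using not_further[of a c a' c'] not_further[of a' c' a c] B eq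
        by (metis linear)
    qed
    define z where "z = a / c"
    have "(e z / d z - z) * (d z / (c + d z)) = (e z / d z - z) * (d z / (c' + d z))"
      using f_eq[OF B(1,2), of z] f_eq[OF B(3,4), of z] z eq unfolding z_def F_def by auto
    \<comment> \<open>The factor \<open>e z / d z - z\<close> cancels because the nearest quotient
      was chosen different from \<open>z\<close>.\<close>
    then have "d z / (c + d z) = d z / (c' + d z)"
      using ed(3)[of z] by simp
    then have "c = c'"
      using nz[OF ed(2), of z] sum_nz[of c z] sum_nz[of c' z] B by (simp add: frac_eq_eq)
    then show "a = a' \<and> c = c'"
      using z nz[OF B(2)] by simp
  qed
  moreover have "F ` (B \<times> B) \<subseteq> sumquot B \<times> UNIV"
  proof -
    have "f (a, c) \<in> sumquot B" if "a \<in> B" "c \<in> B" for a c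
      unfolding f_def sumquot_def using that ed(1,2) sum_nz by (simp, blast)
    then show ?thesis
      by (auto simp: F_def)
  qed
  moreover have "finite (sumquot B \<times> (UNIV :: ((bool \<times> bool) \<times> bool) set))"
    using finite_sumquot[OF assms(1)] by simp
  ultimately have "card (B \<times> B) \<le> card (sumquot B \<times> (UNIV :: ((bool \<times> bool) \<times> bool) set))"
    by (rule card_inj_on_le)
  then show ?thesis
    by (simp add: card_cartesian_product power2_eq_square card_UNIV_bool flip: UNIV_Times_UNIV)
qed

theorem theorem4:
  shows "\<exists>c::real. c > 0 \<and> (\<forall>A::complex set. finite A \<and> A \<noteq> {} \<and> 0 \<notin> A \<longrightarrow>
           real (card (sumquot A)) \<ge> c * real (card A) ^ 2)"
\<comment> \<open>128 = 8 * 4^2: 8 octants, and the factor 4 from the quadrants, squared.\<close>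
proof (intro exI[of _ "1/128"] conjI allI impI)
  fix A :: "complex set"
  assume A: "finite A \<and> A \<noteq> {} \<and> 0 \<notin> A"
  then obtain B where B: "B \<subseteq> A" "card A \<le> 4 * card B"
    "\<forall>c\<in>B. \<forall>d\<in>B. quadrant c = quadrant d"
    using card_le_card_quadrant[of A] by auto
  have fin: "finite B" and "0 \<notin> B"
    using A B finite_subset by auto
  have "card B ^ 2 \<le> 8 * card (sumquot B)"
  proof (cases "\<exists>a\<in>B. \<exists>b\<in>B. a \<noteq> b")
    case True
    then show ?thesis
      using card_sq_le_card_sumquot[OF fin \<open>0 \<notin> B\<close>] B(3) by blast
  next
    \<comment> \<open>For a singleton the only quotient is 1, which has no other quotient as
      neighbour; the bound then only asks that \<open>sumquot B\<close> be nonempty.\<close>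
    case False
    have "B \<noteq> {}"
      using A B(2) by auto
    then obtain a where a: "a \<in> B"
      by auto
    with False have "B = {a}"
      by auto
    moreover have "a + a \<noteq> 0"
      using a \<open>0 \<notin> B\<close> by (auto simp flip: mult_2)
    then have "(a + a) / (a + a) \<in> sumquot B"
      unfolding sumquot_def using a by blast
    then have "card (sumquot B) > 0"
      using finite_sumquot[OF fin] by (auto simp: card_gt_0_iff)
    ultimately show ?thesis
      by simp
  qed
  also have "card (sumquot B) \<le> card (sumquot A)"
    using A B(1) by (intro card_mono finite_sumquot sumquot_mono) auto
  finally have "card B ^ 2 \<le> 8 * card (sumquot A)"
    by simp
  moreover have "card A ^ 2 \<le> (4 * card B) ^ 2"
    using B(2) by (intro power_mono) auto
  ultimately have "card A ^ 2 \<le> 128 * card (sumquot A)"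
    by (simp add: power_mult_distrib)
  then have "real (card A ^ 2) \<le> real (128 * card (sumquot A))"
    by (rule of_nat_mono)
  then show "real (card (sumquot A)) \<ge> 1/128 * real (card A) ^ 2"
    by simp
qed simp

end
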